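(* Let $N\ge1$ and let $W=(w_1,u_1,\dots,w_N,u_N,\sigma^2)\in\Omega_W$ be an equilibrium state, i.e. $$\sum_{i=1}^Nw_i\Delta_j(u_i,\sigma^2)=\rho\,\Delta_j(U,\theta)\qquad\text{for } j=0,1,\dots,2N.$$ Then $W\in\Omega_W^{eq}$; more precisely, $$u_1=\dots=u_N=U,\qquad \sigma^2=\theta,\qquad \sum_{i=1}^Nw_i=\rho .$$ Hence, at equilibrium, $\bar M_{2N+1}=\rho\,\Delta_{2N+1}(U,\theta)$.
   Context: $\Delta_j(u,\vartheta)$ denotes the $j$th moment $\int_{\mathbb R}\xi^j\frac{1}{\sqrt{2\pi\vartheta}}e^{-(\xi-u)^2/(2\vartheta)}d\xi$ of the Gaussian with mean $u$ and variance $\vartheta>0$. $\Omega_W=\Omega_W^{open}\cup\Omega_W^{eq}\subset\mathbb{R}^{2N+1}$, where $\Omega_W^{open}=\{W: w_i>0,\ \sigma^2>0,\ u_i\ne u_j\ \forall i\ne j\}$ and $\Omega_W^{eq}=\{W: w_i>0,\ \sigma^2>0,\ u_1=\dots=u_N\}$. For $W\in\Omega_W$ set $M_j=\sum_{i=1}^Nw_i\Delta_j(u_i,\sigma^2)$ ($0\le j\le 2N$) and $\bar M_{2N+1}=\sum_{i=1}^Nw_i\Delta_{2N+1}(u_i,\sigma^2)$. The macroscopic parameters $\rho,U,\theta$ are defined from $W$ by $M_0=\rho$, $M_1=\rho U$, $M_2=\rho(U^2+\theta)$ (automatically $\rho>0$, $\theta>0$). The equilibrium states are the zeros of the BGK source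 term $S(M)=\rho(\Delta_0(U,\theta),\dots,\Delta_{2N}(U,\theta))^T-M$. *)

theory Defs
  imports "HOL-Probability.Probability"
begin

text \<open>
  The number of nodes is \<open>N = CARD('n)\<close>, so every \<open>N \<ge> 1\<close> is covered. A point
  \<open>W = (w\<^sub>1, u\<^sub>1, \<dots>, w\<^sub>N, u\<^sub>N, \<sigma>\<^sup>2)\<close> of \<open>\<real>\<^sup>2\<^sup>N\<^sup>+\<^sup>1\<close> is represented, with its coordinates
  regrouped, as a triple \<open>(w, u, \<sigma>\<^sup>2)\<close>. Throughout, \<open>s\<close> and \<open>\<theta>\<close> stand for variances, i.e. \<open>s\<close> is
  \<open>\<sigma>\<^sup>2\<close> itself and not the standard deviation.
\<close>

text \<open>
  This is the \<open>j\<close>-th moment of the Gaussian with mean \<open>u\<close> and variance \<open>\<theta>\<close> only if \<open>\<theta> > 0\<close>.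
\<close>

definition Gauss_moment :: "nat \<Rightarrow> real \<Rightarrow> real \<Rightarrow> real" where
  "Gauss_moment j u \<theta> =
     (LBINT \<xi>. \<xi> ^ j * (1 / sqrt (2 * pi * \<theta>) * exp (- (\<xi> - u)\<^sup>2 / (2 * \<theta>))))"

type_synonym 'n state = "(real ^ 'n) \<times> (real ^ 'n) \<times> real"

definition Omega_open :: "'n::finite state set" where
  "Omega_open = {(w, u, s). (\<forall>i. w $ i > 0) \<and> s > 0 \<and> (\<forall>i j. i \<noteq> j \<longrightarrow> u $ i \<noteq> u $ j)}"

definition Omega_eq :: "'n::finite state set" where
  "Omega_eq = {(w, u, s). (\<forall>i. w $ i > 0) \<and> s > 0 \<and> (\<forall>i j. u $ i = u $ j)}"

definition Omega_W :: "'n::finite state set" where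
  "Omega_W = Omega_open \<union> Omega_eq"

text \<open>
  For \<open>j \<le> 2N\<close> this is the moment \<open>M\<^sub>j\<close>; for \<open>j = 2N + 1\<close> it is the closure moment.
\<close>

definition moment :: "'n::finite state \<Rightarrow> nat \<Rightarrow> real" where
  "moment = (\<lambda>(w, u, s) j. \<Sum>i\<in>UNIV. w $ i * Gauss_moment j (u $ i) s)"

definition closure_moment :: "'n::finite state \<Rightarrow> real" where
  "closure_moment W = moment W (2 * CARD('n) + 1)"

text \<open>
  The macroscopic parameters of a moment sequence are the solution of \<open>M\<^sub>0 = \<rho>\<close>, \<open>M\<^sub>1 = \<rho> U\<close>,
  \<open>M\<^sub>2 = \<rho> (U\<^sup>2 + \<theta>)\<close>; see \<open>macroscopic_parameters\<close> below.
\<close>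

definition density :: "(nat \<Rightarrow> real) \<Rightarrow> real" where
  "density M = M 0"

definition bulk_velocity :: "(nat \<Rightarrow> real) \<Rightarrow> real" where
  "bulk_velocity M = M 1 / M 0"

definition temperature :: "(nat \<Rightarrow> real) \<Rightarrow> real" where
  "temperature M = M 2 / M 0 - (bulk_velocity M)\<^sup>2"

definition BGK_source :: "(nat \<Rightarrow> real) \<Rightarrow> nat \<Rightarrow> real" where
  "BGK_source M j = density M * Gauss_moment j (bulk_velocity M) (temperature M) - M j"

text \<open>Only the components \<open>0, \<dots>, 2N\<close> belong to the source vector.\<close>

definition equilibrium :: "'n::finite state \<Rightarrow> bool" where
  "equilibrium W \<longleftrightarrow> (\<forall>j\<le>2 * CARD('n). BGK_source (moment W) j = 0)"

lemma equilibrium_iff: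
  fixes w u :: "real ^ 'n::finite"
  shows "equilibrium (w, u, s) \<longleftrightarrow>
    (\<forall>j\<le>2 * CARD('n).
      (\<Sum>i\<in>UNIV. w $ i * Gauss_moment j (u $ i) s) =
      density (moment (w, u, s)) *
        Gauss_moment j (bulk_velocity (moment (w, u, s))) (temperature (moment (w, u, s))))"
  unfolding equilibrium_def BGK_source_def moment_def by auto

lemma Gauss_moment_0:
  assumes "\<theta> > 0"
  shows "Gauss_moment 0 u \<theta> = 1"
proof -
  have "Gauss_moment 0 u \<theta> = (LBINT \<xi>. normal_density u (sqrt \<theta>) \<xi>)"
    using assms by (simp add: Gauss_moment_def normal_density_def)
  then show ?thesis
    using assms by (simp add: integral_normal_density)
qed

lemma density_pos:
  fixes W :: "'n::finite state"
  assumes "W \<in> Omega_W"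
  shows "density (moment W) > 0"
  using assms
  by (auto simp: Omega_W_def Omega_open_def Omega_eq_def density_def moment_def Gauss_moment_0
      intro!: sum_pos)

lemma macroscopic_parameters:
  fixes W :: "'n::finite state"
  assumes "W \<in> Omega_W"
  shows "moment W 0 = \<rho> \<and> moment W 1 = \<rho> * U \<and> moment W 2 = \<rho> * (U\<^sup>2 + \<theta>) \<longleftrightarrow>
    \<rho> = density (moment W) \<and> U = bulk_velocity (moment W) \<and> \<theta> = temperature (moment W)"
proof -
  have "a = \<rho> \<and> b = \<rho> * U \<and> c = \<rho> * (U\<^sup>2 + \<theta>) \<longleftrightarrow> \<rho> = a \<and> U = b / a \<and> \<theta> = c / a - (b / a)\<^sup>2"
    if "a > 0" for a b c :: real
  proof -
    have "U = b / a \<longleftrightarrow> b = a * U"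
      using that by (auto simp: field_simps)
    moreover have "\<theta> = c / a - U\<^sup>2 \<longleftrightarrow> c = a * (U\<^sup>2 + \<theta>)"
      using that by (auto simp: field_simps)
    ultimately show ?thesis
      by auto
  qed
  then show ?thesis
    using density_pos[OF assms] by (simp add: density_def bulk_velocity_def temperature_def)
qed

end

theory Submission
  imports Defs
begin

text \<open>
  Compare the mixture \<open>\<Sum>i. w\<^sub>i N(u\<^sub>i, s)\<close> with the single Gaussian \<open>\<rho> N(U, \<theta>)\<close>. If \<open>\<theta> > s\<close>, then
  both are convolutions with the same Gaussian \<open>N(0, s)\<close>: of the discrete measure
  \<open>\<Sum>i. w\<^sub>i \<delta>(u\<^sub>i)\<close> in the first case, of \<open>\<rho> N(U, \<theta> - s)\<close> in the second. On polynomials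
  of degree at most \<open>2N\<close> the convolution acts as an invertible triangular map, so it can be cancelled
  there: the equality of the moments up to \<open>2N\<close> says that the two uncovered measures integrate all
  these polynomials alike (\<open>mixture_deconvolution\<close>). The polynomial \<open>\<Prod>i. (X - u\<^sub>i)\<^sup>2\<close> has degree
  \<open>2N\<close>. The discrete measure gives it the integral \<open>0\<close>, whereas every nondegenerate Gaussian gives
  it a positive integral. Hence \<open>\<theta> \<le> s\<close> (\<open>mixture_moments_imp_variance_le\<close>).

  On the other hand, the moments of order \<open>0\<close>, \<open>1\<close>, \<open>2\<close> alone give the decomposition of the variance
  \<open>\<rho> (\<theta> - s) = \<Sum>i. w\<^sub>i (u\<^sub>i - U)\<^sup>2\<close>. Its right-hand side is nonnegative, so \<open>\<theta> = s\<close>, and then all its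
  terms vanish, which means \<open>u\<^sub>i = U\<close> because the weights are positive.

  The deconvolution is carried out on polynomials only. The moment \<open>\<Delta>\<^sub>n(v, s)\<close> is a monic polynomial
  of degree \<open>n\<close> in \<open>v\<close>, the heat polynomial, and the semigroup law \<open>N(0, s) * N(U, \<tau>) = N(U, s + \<tau>)\<close>
  becomes the statement that averaging it over \<open>N(U, \<tau>)\<close> yields \<open>\<Delta>\<^sub>n(U, s + \<tau>)\<close>
  (\<open>Gauss_mean_heat_poly\<close>). Both facts follow from Stein's identity
  \<open>E (X p(X)) = u E p(X) + \<theta> E p'(X)\<close> for \<open>X\<close> distributed as \<open>N(u, \<theta>)\<close>.
\<close>

section \<open>Reduction to a monic family of polynomials\<close>

text \<open>
  A family with one monic member of each degree up to \<open>m\<close> is a basis of the polynomials of degree at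
  most \<open>m\<close>, so a linear property has to be checked on the family only. The families used below are the
  powers of \<open>X - u\<close>, for which Gaussian integrals are known explicitly, and the heat polynomials.
\<close>

lemma monic_basis_induct:
  fixes b :: "nat \<Rightarrow> 'a::comm_ring_1 poly"
  assumes b: "\<And>n. n \<le> m \<Longrightarrow> degree (b n) \<le> n" "\<And>n. n \<le> m \<Longrightarrow> coeff (b n) n = 1"
    and zero: "P 0"
    and basis: "\<And>n. n \<le> m \<Longrightarrow> P (b n)"
    and lin: "\<And>p q c. P p \<Longrightarrow> P q \<Longrightarrow> P (p + smult c q)"
    and "degree p \<le> m"
  shows "P p"
proof -
  \<comment> \<open>With the strict bound \<open>degree p < n\<close> written in coefficients, the induction starts at the zero
    polynomial, and subtracting a multiple of \<open>b n\<close> removes one coefficient at each step.\<close>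
  have "P p" if "n \<le> Suc m" "\<forall>i\<ge>n. coeff p i = 0" for n p
    using that
  proof (induction n arbitrary: p)
    case 0
    then have "p = 0"
      by (simp add: poly_eq_iff)
    then show ?case
      by (simp add: zero)
  next
    case (Suc n)
    let ?r = "p - smult (coeff p n) (b n)"
    have r: "coeff ?r i = 0" if "i \<ge> n" for i
    proof (cases "i = n")
      case False
      with that have "coeff (b n) i = 0"
        using b(1)[of n] Suc.prems(1) by (intro coeff_eq_0) auto
      with False that Suc.prems(2) show ?thesis
        by simp
    qed (use b(2)[of n] Suc.prems(1) in simp)
    have "P ?r"
      by (rule Suc.IH) (use Suc.prems(1) in simp, use r in blast)
    then have "P (?r + smult (coeff p n) (b n))"
      using Suc.prems(1) by (intro lin basis) auto
    then show ?case
      by (simp only: diff_add_cancel)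
  qed
  from this[of "Suc m"] assms(6) show ?thesis
    by (simp add: coeff_eq_0)
qed

section \<open>Gaussian integrals of polynomials\<close>

definition Gauss_mean :: "real \<Rightarrow> real \<Rightarrow> real poly \<Rightarrow> real" where
  "Gauss_mean u \<theta> p = (LBINT x. normal_density u (sqrt \<theta>) x * poly p x)"

lemma integrable_normal_density_poly:
  assumes "\<sigma> > 0"
  shows "integrable lborel (\<lambda>x. normal_density \<mu> \<sigma> x * poly p x)"
proof (rule monic_basis_induct[where b = "\<lambda>k. [:-\<mu>, 1:] ^ k" and m = "degree p"
      and P = "\<lambda>p. integrable lborel (\<lambda>x. normal_density \<mu> \<sigma> x * poly p x)"])
  show "integrable lborel (\<lambda>x. normal_density \<mu> \<sigma> x * poly ([:-\<mu>, 1:] ^ k) x)" for k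
    using integrable_normal_moment[OF assms, of \<mu> k] by (simp add: poly_power)
next
  fix p q c
  assume *: "integrable lborel (\<lambda>x. normal_density \<mu> \<sigma> x * poly p x)"
    "integrable lborel (\<lambda>x. normal_density \<mu> \<sigma> x * poly q x)"
  have "integrable lborel
      (\<lambda>x. normal_density \<mu> \<sigma> x * poly p x + c * (normal_density \<mu> \<sigma> x * poly q x))"
    using * by (intro Bochner_Integration.integrable_add integrable_mult_right)
  then show "integrable lborel (\<lambda>x. normal_density \<mu> \<sigma> x * poly (p + smult c q) x)"
    by (simp only: poly_add poly_smult distrib_left mult.left_commute)
qed (simp_all add: degree_linear_power coeff_linear_power)

lemma Gauss_mean_0 [simp]: "Gauss_mean u \<theta> 0 = 0"
  by (simp add: Gauss_mean_def)

lemma Gauss_mean_add: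
  assumes "\<theta> > 0"
  shows "Gauss_mean u \<theta> (p + q) = Gauss_mean u \<theta> p + Gauss_mean u \<theta> q"
  unfolding Gauss_mean_def poly_add distrib_left
  using assms by (intro Bochner_Integration.integral_add integrable_normal_density_poly) simp_all

lemma Gauss_mean_smult: "Gauss_mean u \<theta> (smult c p) = c * Gauss_mean u \<theta> p"
  by (simp add: Gauss_mean_def mult.left_commute)

lemma Gauss_mean_1:
  assumes "\<theta> > 0"
  shows "Gauss_mean u \<theta> 1 = 1"
  using assms by (simp add: Gauss_mean_def integral_normal_density)

lemma Gauss_mean_monom:
  assumes "\<theta> > 0"
  shows "Gauss_mean u \<theta> (monom 1 j) = Gauss_moment j u \<theta>"
  using assms by (simp add: Gauss_mean_def Gauss_moment_def normal_density_def poly_monom mult.commute)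

text \<open>
  Stein's identity for the powers of \<open>X - u\<close> amounts to \<open>c\<^sub>1 = 0\<close> and the recursion
  \<open>c\<^sub>k\<^sub>+\<^sub>2 = (k + 1) \<theta> c\<^sub>k\<close> of the central moments, read off from their closed form.
\<close>

lemma Gauss_mean_central_Suc:
  assumes "\<theta> > 0"
  shows "Gauss_mean u \<theta> ([:-u, 1:] ^ Suc k) = \<theta> * Gauss_mean u \<theta> (pderiv ([:-u, 1:] ^ k))"
proof -
  define c where "c k = Gauss_mean u \<theta> ([:-u, 1:] ^ k)" for k
  have c: "c k = (LBINT x. normal_density u (sqrt \<theta>) x * (x - u) ^ k)" for k
    by (simp add: c_def Gauss_mean_def poly_power)
  have odd: "c (2 * j + 1) = 0" for j
    unfolding c using assms by (intro has_bochner_integral_integral_eq normal_moment_odd) simp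
  have even: "c (2 * j) = fact (2 * j) / ((2 / \<theta>) ^ j * fact j)" for j
    unfolding c using normal_moment_even[of "sqrt \<theta>" u j] assms
    by (simp add: has_bochner_integral_integral_eq)
  have rec: "c (Suc (Suc k)) = \<theta> * real (Suc k) * c k" for k
  proof (cases "even k")
    case True
    then obtain j where k: "k = 2 * j" by blast
    have "c (2 * Suc j) = \<theta> * real (Suc (2 * j)) * c (2 * j)"
    proof -
      have "(fact (2 * Suc j) :: real) = 2 * real (Suc j) * real (Suc (2 * j)) * fact (2 * j)"
        by (simp add: algebra_simps)
      then show ?thesis
        unfolding even using assms by (simp add: power_divide divide_simps del: of_nat_Suc)
    qed
    then show ?thesis
      by (simp add: k)
  next
    case False
    then obtain j where k: "k = 2 * j + 1" by (blast elim: oddE)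
    show ?thesis
      using odd[of j] odd[of "Suc j"] by (simp add: k)
  qed
  show ?thesis
  proof (cases k)
    case 0
    then show ?thesis
      using odd[of 0] by (simp add: c_def pderiv_1)
  next
    case (Suc n)
    have "pderiv ([:-u, 1:] ^ Suc n) = smult (real (Suc n)) ([:-u, 1:] ^ n)"
      unfolding pderiv_power_Suc by (simp add: pderiv_pCons del: of_nat_Suc)
    then have "\<theta> * Gauss_mean u \<theta> (pderiv ([:-u, 1:] ^ k)) = \<theta> * real (Suc n) * c n"
      unfolding Suc by (simp only: Gauss_mean_smult c_def mult.assoc)
    with rec[of n] show ?thesis
      unfolding Suc by (simp only: c_def)
  qed
qed

text \<open>
  Both the recursion for the moments and the semigroup law come from this identity. It is usually
  obtained by integrating by parts; for polynomials, linearity and the case of central powers give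
  it without any analysis at infinity.
\<close>

lemma Gauss_mean_Stein:
  assumes "\<theta> > 0"
  shows "Gauss_mean u \<theta> ([:0, 1:] * p) = u * Gauss_mean u \<theta> p + \<theta> * Gauss_mean u \<theta> (pderiv p)"
proof -
  note lin = Gauss_mean_add[OF assms] Gauss_mean_smult
  have "Gauss_mean u \<theta> ([:-u, 1:] * p) = \<theta> * Gauss_mean u \<theta> (pderiv p)"
  proof (rule monic_basis_induct[where b = "\<lambda>k. [:-u, 1:] ^ k" and m = "degree p"
        and P = "\<lambda>p. Gauss_mean u \<theta> ([:-u, 1:] * p) = \<theta> * Gauss_mean u \<theta> (pderiv p)"])
    show "Gauss_mean u \<theta> ([:-u, 1:] * [:-u, 1:] ^ k) =
        \<theta> * Gauss_mean u \<theta> (pderiv ([:-u, 1:] ^ k))" for k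
      using Gauss_mean_central_Suc[OF assms, of u k] by (simp only: power_Suc)
  next
    fix p q c
    assume *: "Gauss_mean u \<theta> ([:-u, 1:] * p) = \<theta> * Gauss_mean u \<theta> (pderiv p)"
      "Gauss_mean u \<theta> ([:-u, 1:] * q) = \<theta> * Gauss_mean u \<theta> (pderiv q)"
    show "Gauss_mean u \<theta> ([:-u, 1:] * (p + smult c q)) =
        \<theta> * Gauss_mean u \<theta> (pderiv (p + smult c q))"
      unfolding distrib_left mult_smult_right lin pderiv_add pderiv_smult *
      by (simp add: algebra_simps)
  qed (simp_all add: degree_linear_power coeff_linear_power)
  moreover have "[:0, 1:] * p = [:-u, 1:] * p + smult u p"
    by simp
  ultimately show ?thesis
    by (simp only: lin)
qed

text \<open>
  The density is positive everywhere and a nonzero polynomial vanishes only on a finite set, which is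
  null for the Lebesgue measure.
\<close>

lemma Gauss_mean_square_pos:
  assumes "\<theta> > 0" and "p \<noteq> 0"
  shows "Gauss_mean u \<theta> (p\<^sup>2) > 0"
proof -
  let ?f = "\<lambda>x. normal_density u (sqrt \<theta>) x * poly (p\<^sup>2) x"
  have int: "integrable lborel ?f"
    using assms(1) by (intro integrable_normal_density_poly) simp
  have nonneg: "AE x in lborel. 0 \<le> ?f x"
    by (simp add: poly_power)
  have "Gauss_mean u \<theta> (p\<^sup>2) \<noteq> 0"
  proof
    assume "Gauss_mean u \<theta> (p\<^sup>2) = 0"
    then have "AE x in lborel. ?f x = 0"
      using integral_nonneg_eq_0_iff_AE[OF int nonneg] by (simp add: Gauss_mean_def)
    moreover have "?f x \<noteq> 0" if "poly p x \<noteq> 0" for x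
      using that assms(1) normal_density_pos[of "sqrt \<theta>" u x] by (simp add: poly_power)
    ultimately have "AE x in lborel. poly p x = 0"
      by (auto elim!: eventually_mono)
    moreover have "AE x in lborel. x \<notin> {x. poly p x = 0}"
      using poly_roots_finite[OF assms(2)]
      by (intro AE_not_in finite_imp_null_set_lborel)
    ultimately have "AE x in (lborel :: real measure). False"
      by eventually_elim simp
    then show False
      by (simp add: eventually_False ae_filter_eq_bot_iff)
  qed
  moreover have "Gauss_mean u \<theta> (p\<^sup>2) \<ge> 0"
    unfolding Gauss_mean_def using nonneg by (rule integral_nonneg_AE)
  ultimately show ?thesis
    by simp
qed

section \<open>Heat polynomials\<close>

text \<open>
  The polynomial \<open>exp ((s / 2) D\<^sup>2) X\<^sup>n\<close>, where \<open>D\<close> is the derivative: the solution at time \<open>s\<close> of the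
  heat equation \<open>f\<^sub>t = f'' / 2\<close> with initial value \<open>X\<^sup>n\<close>. For \<open>s = -1\<close> it is the Hermite polynomial of
  probability theory. The three-term recursion is the form that Stein's identity produces.
\<close>

fun heat_poly :: "real \<Rightarrow> nat \<Rightarrow> real poly" where
  "heat_poly s 0 = 1"
| "heat_poly s (Suc 0) = [:0, 1:]"
| "heat_poly s (Suc (Suc n)) =
     [:0, 1:] * heat_poly s (Suc n) + smult (s * real (Suc n)) (heat_poly s n)"

lemma degree_heat_poly: "degree (heat_poly s n) \<le> n"
proof (induction s n rule: heat_poly.induct)
  case (3 s n)
  have "degree ([:0, 1:] * heat_poly s (Suc n)) \<le> Suc (Suc n)"
    using degree_mult_le[of "[:0, 1:]" "heat_poly s (Suc n)"] 3 by simp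
  moreover have "degree (smult (s * real (Suc n)) (heat_poly s n)) \<le> Suc (Suc n)"
    using degree_smult_le[of "s * real (Suc n)" "heat_poly s n"] 3 by linarith
  ultimately show ?case
    unfolding heat_poly.simps by (rule degree_add_le)
qed auto

lemma coeff_heat_poly: "coeff (heat_poly s n) n = 1"
proof (induction s n rule: heat_poly.induct)
  case (3 s n)
  have "coeff (heat_poly s n) (Suc (Suc n)) = 0"
    using degree_heat_poly[of s n] by (intro coeff_eq_0) simp
  with 3 show ?case
    by simp
qed auto

lemma pderiv_heat_poly: "pderiv (heat_poly s (Suc n)) = smult (real (Suc n)) (heat_poly s n)"
proof (induction n rule: induct_nat_012)
  case (ge2 n)
  show ?case
    unfolding heat_poly.simps(3)[of s "Suc n"] pderiv_add pderiv_mult pderiv_smult ge2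
    by (simp add: pderiv_pCons poly_eq_poly_eq_iff[symmetric] fun_eq_iff algebra_simps)
next
  case 1
  show ?case
    by (simp add: pderiv_mult pderiv_add pderiv_smult pderiv_pCons)
qed (simp add: pderiv_pCons)

text \<open>
  Stein's identity for \<open>X\<^sup>n\<^sup>+\<^sup>1\<close> is the defining recursion of the heat polynomials.
\<close>

lemma Gauss_moment_eq_heat_poly:
  assumes "s > 0"
  shows "Gauss_moment n v s = poly (heat_poly s n) v"
proof (induction n rule: induct_nat_012)
  case 0
  then show ?case
    by (simp add: Gauss_moment_0 assms)
next
  case 1
  then show ?case
    using Gauss_mean_Stein[OF assms, of v 1] Gauss_mean_monom[OF assms, of v 1]
    by (simp add: assms Gauss_mean_1 monom_Suc pCons_one)
next
  case (ge2 n)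
  have "Gauss_moment (Suc (Suc n)) v s = Gauss_mean v s ([:0, 1:] * monom 1 (Suc n))"
    by (simp add: assms monom_Suc flip: Gauss_mean_monom)
  also have "\<dots> = v * Gauss_moment (Suc n) v s + s * real (Suc n) * Gauss_moment n v s"
    unfolding Gauss_mean_Stein[OF assms] pderiv_monom
    using Gauss_mean_smult[of v s "real (Suc n)" "monom 1 n"]
    by (simp add: assms Gauss_mean_monom smult_monom)
  also have "\<dots> = poly (heat_poly s (Suc (Suc n))) v"
    by (simp add: ge2)
  finally show ?case .
qed

text \<open>
  The semigroup law of the heat flow. In the recursion, Stein's identity for \<open>N(u, \<tau>)\<close> contributes
  \<open>\<tau>\<close> times the derivative of \<open>heat_poly s (n + 1)\<close>, which is \<open>n + 1\<close> times \<open>heat_poly s n\<close>; this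
  raises the coefficient \<open>s (n + 1)\<close> to \<open>(s + \<tau>) (n + 1)\<close>.
\<close>

lemma Gauss_mean_heat_poly:
  assumes "\<tau> > 0"
  shows "Gauss_mean u \<tau> (heat_poly s n) = poly (heat_poly (s + \<tau>) n) u"
proof (induction n rule: induct_nat_012)
  case 0
  then show ?case
    by (simp add: Gauss_mean_1 assms)
next
  case 1
  then show ?case
    using Gauss_mean_Stein[OF assms, of u 1] by (simp add: assms Gauss_mean_1)
next
  case (ge2 n)
  then show ?case
    unfolding heat_poly.simps Gauss_mean_add[OF assms] Gauss_mean_Stein[OF assms]
      pderiv_heat_poly Gauss_mean_smult
    by (simp add: algebra_simps)
qed

section \<open>Mixtures of Gaussians with the moments of a Gaussian\<close>

text \<open>
  For the heat polynomials with parameter \<open>s\<close> the conclusion is precisely the assumption on the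
  moments, since by the semigroup law averaging \<open>heat_poly s j\<close> over \<open>N(U, \<theta> - s)\<close> gives
  \<open>heat_poly \<theta> j\<close> at \<open>U\<close>. These polynomials form a monic family.
\<close>

lemma mixture_deconvolution:
  fixes w u :: "'i \<Rightarrow> real"
  assumes "s > 0" and "s < \<theta>"
    and mom: "\<And>j. j \<le> m \<Longrightarrow> (\<Sum>i\<in>I. w i * Gauss_moment j (u i) s) = \<rho> * Gauss_moment j U \<theta>"
    and "degree p \<le> m"
  shows "(\<Sum>i\<in>I. w i * poly p (u i)) = \<rho> * Gauss_mean U (\<theta> - s) p"
proof (rule monic_basis_induct[where b = "heat_poly s" and m = m])
  show "(\<Sum>i\<in>I. w i * poly (heat_poly s j) (u i)) = \<rho> * Gauss_mean U (\<theta> - s) (heat_poly s j)"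
    if "j \<le> m" for j
    using mom[OF that] assms(1,2) by (simp add: Gauss_moment_eq_heat_poly Gauss_mean_heat_poly)
next
  fix p q c
  assume "(\<Sum>i\<in>I. w i * poly p (u i)) = \<rho> * Gauss_mean U (\<theta> - s) p"
    "(\<Sum>i\<in>I. w i * poly q (u i)) = \<rho> * Gauss_mean U (\<theta> - s) q"
  moreover have "(\<Sum>i\<in>I. w i * poly (p + smult c q) (u i)) =
      (\<Sum>i\<in>I. w i * poly p (u i)) + c * (\<Sum>i\<in>I. w i * poly q (u i))"
    by (simp add: algebra_simps sum.distrib sum_distrib_left)
  ultimately show "(\<Sum>i\<in>I. w i * poly (p + smult c q) (u i)) =
      \<rho> * Gauss_mean U (\<theta> - s) (p + smult c q)"
    using assms(2) by (simp add: Gauss_mean_add Gauss_mean_smult algebra_simps)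
qed (use assms(4) in \<open>auto simp: degree_heat_poly coeff_heat_poly\<close>)

text \<open>
  If \<open>\<theta>\<close> were larger than \<open>s\<close>, the measure with atoms at the \<open>u i\<close> would integrate the square of
  their node polynomial like a multiple of a nondegenerate Gaussian. The order \<open>2 * card I\<close> is the
  degree of this square.
\<close>

lemma mixture_moments_imp_variance_le:
  fixes w u :: "'i \<Rightarrow> real"
  assumes "finite I" and "s > 0" and "\<rho> > 0"
    and mom: "\<And>j. j \<le> 2 * card I \<Longrightarrow>
      (\<Sum>i\<in>I. w i * Gauss_moment j (u i) s) = \<rho> * Gauss_moment j U \<theta>"
  shows "\<theta> \<le> s"
proof (rule ccontr)
  assume "\<not> \<theta> \<le> s"
  then have less: "s < \<theta>"
    by simp
  define p where "p = (\<Prod>i\<in>I. [:- u i, 1:])"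
  have "degree p \<le> card I"
    using degree_prod_sum_le[OF \<open>finite I\<close>, of "\<lambda>i. [:- u i, 1:]"] by (simp add: p_def)
  then have deg: "degree (p\<^sup>2) \<le> 2 * card I"
    using degree_power_le[of p 2] by simp
  have "p \<noteq> 0"
    by (simp add: p_def \<open>finite I\<close>)
  have "poly p (u i) = 0" if "i \<in> I" for i
    using that \<open>finite I\<close> by (auto simp: p_def poly_prod)
  then have "(\<Sum>i\<in>I. w i * poly (p\<^sup>2) (u i)) = 0"
    by (simp add: poly_power)
  moreover have "\<rho> * Gauss_mean U (\<theta> - s) (p\<^sup>2) > 0"
    using less \<open>\<rho> > 0\<close> Gauss_mean_square_pos[OF _ \<open>p \<noteq> 0\<close>] by simp
  ultimately show False
    using mixture_deconvolution[OF \<open>s > 0\<close> less mom deg] by (metis less_irrefl)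
qed

theorem theorem4p11:
  fixes w u :: "real ^ 'n::finite" and s \<rho> U \<theta> :: real
  assumes "(w, u, s) \<in> Omega_W"
    and "moment (w, u, s) 0 = \<rho>"
    and "moment (w, u, s) 1 = \<rho> * U"
    and "moment (w, u, s) 2 = \<rho> * (U\<^sup>2 + \<theta>)"
    and "equilibrium (w, u, s)"
  shows "(w, u, s) \<in> Omega_eq \<and>
    (\<forall>i. u $ i = U) \<and> s = \<theta> \<and> (\<Sum>i\<in>UNIV. w $ i) = \<rho> \<and>
    closure_moment (w, u, s) = \<rho> * Gauss_moment (2 * CARD('n) + 1) U \<theta>"
proof -
  have s: "s > 0" and w: "\<And>i. w $ i > 0"
    using assms(1) by (auto simp: Omega_W_def Omega_open_def Omega_eq_def)
  have macro: "\<rho> = density (moment (w, u, s))" "U = bulk_velocity (moment (w, u, s))"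
    "\<theta> = temperature (moment (w, u, s))"
    using macroscopic_parameters[OF assms(1), of \<rho> U \<theta>] assms(2-4) by blast+
  have \<rho>: "\<rho> > 0"
    using density_pos[OF assms(1)] macro(1) by simp
  have "(\<Sum>i\<in>UNIV. w $ i * Gauss_moment j (u $ i) s) = \<rho> * Gauss_moment j U \<theta>"
    if "j \<le> 2 * CARD('n)" for j
    using assms(5) that unfolding equilibrium_iff macro by blast
  then have le: "\<theta> \<le> s"
    using s \<rho>
    by (intro mixture_moments_imp_variance_le[of UNIV s \<rho> "\<lambda>i. w $ i" "\<lambda>i. u $ i" U \<theta>]) auto
  have M0: "(\<Sum>i\<in>UNIV. w $ i) = \<rho>"
    using assms(2) s by (simp add: moment_def Gauss_moment_0)
  have M1: "(\<Sum>i\<in>UNIV. w $ i * u $ i) = \<rho> * U"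
    using assms(3) s by (simp add: moment_def Gauss_moment_eq_heat_poly)
  have M2: "(\<Sum>i\<in>UNIV. w $ i * ((u $ i)\<^sup>2 + s)) = \<rho> * (U\<^sup>2 + \<theta>)"
    using assms(4) s
    by (simp add: moment_def Gauss_moment_eq_heat_poly numeral_2_eq_2 add.commute)
  have "(\<Sum>i\<in>UNIV. w $ i * (u $ i - U)\<^sup>2) =
      (\<Sum>i\<in>UNIV. w $ i * ((u $ i)\<^sup>2 + s) - 2 * U * (w $ i * u $ i) + (U\<^sup>2 - s) * w $ i)"
    by (intro sum.cong) (auto simp: power2_eq_square algebra_simps)
  also have "\<dots> = \<rho> * (U\<^sup>2 + \<theta>) - 2 * U * (\<rho> * U) + (U\<^sup>2 - s) * \<rho>"
    unfolding sum.distrib sum_subtractf sum_distrib_left[symmetric] M0 M1 M2 ..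
  also have "\<dots> = \<rho> * (\<theta> - s)"
    by (simp add: power2_eq_square algebra_simps)
  finally have var: "(\<Sum>i\<in>UNIV. w $ i * (u $ i - U)\<^sup>2) = \<rho> * (\<theta> - s)" .
  have nonneg: "w $ i * (u $ i - U)\<^sup>2 \<ge> 0" for i
    using w[of i] by simp
  have "\<rho> * (\<theta> - s) \<ge> 0"
    unfolding var[symmetric] by (intro sum_nonneg nonneg)
  with le \<rho> have "s = \<theta>"
    by (simp add: zero_le_mult_iff)
  moreover have u: "u $ i = U" for i
  proof -
    have "w $ i * (u $ i - U)\<^sup>2 = 0"
      using var \<open>s = \<theta>\<close> nonneg sum_nonneg_eq_0_iff[of UNIV "\<lambda>i. w $ i * (u $ i - U)\<^sup>2"] by simp
    with w[of i] show ?thesis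
      by simp
  qed
  moreover have "(w, u, s) \<in> Omega_eq"
    using w s u by (simp add: Omega_eq_def)
  moreover have "closure_moment (w, u, s) = \<rho> * Gauss_moment (2 * CARD('n) + 1) U \<theta>"
    unfolding closure_moment_def moment_def using u \<open>s = \<theta>\<close> M0
    by (simp add: sum_distrib_right[symmetric])
  ultimately show ?thesis
    using M0 by blast
qed

end
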